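(* Let $X$ be a topological space with only one non-isolated point. Then $X$ has a monotone open closure-preserving operator.
   Context: A family $\mathcal A$ of subsets of $X$ refines a family $\mathcal B$ of subsets of $X$ if every $A\in\mathcal A$ is contained in some $B\in\mathcal B$. A family $\mathcal F$ of subsets of a space $X$ is closure-preserving if $\overline{\bigcup\mathcal H}=\bigcup\{\overline H:H\in\mathcal H\}$ for every subfamily $\mathcal H\subseteq\mathcal F$. A monotone closure-preserving operator for $X$ is a function $r$ assigning to every open cover $\mathcal U$ of $X$ a closure-preserving cover $r(\mathcal U)$ of $X$ (by arbitrary subsets) that refines $\mathcal U$, such that whenever $\mathcal U,\mathcal V$ are open covers and $\mathcal U$ refines $\mathcal V$, then $r(\mathcal U)$ refines $r(\mathcal V)$. If in addition every member of every $r(\mathcal U)$ is open, $r$ is called a monotone open closure-preserving operator. *)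

theory Defs
  imports "HOL-Analysis.Abstract_Topology"
begin

definition refines :: "'a set set \<Rightarrow> 'a set set \<Rightarrow> bool" where
  "refines \<A> \<B> \<longleftrightarrow> (\<forall>A\<in>\<A>. \<exists>B\<in>\<B>. A \<subseteq> B)"

definition cover_of :: "'a topology \<Rightarrow> 'a set set \<Rightarrow> bool" where
  "cover_of X \<U> \<longleftrightarrow> \<Union>\<U> = topspace X"

definition open_cover_of :: "'a topology \<Rightarrow> 'a set set \<Rightarrow> bool" where
  "open_cover_of X \<U> \<longleftrightarrow> cover_of X \<U> \<and> (\<forall>U\<in>\<U>. openin X U)"

definition closure_preserving :: "'a topology \<Rightarrow> 'a set set \<Rightarrow> bool" where
  "closure_preserving X \<F> \<longleftrightarrow>
     (\<forall>F\<in>\<F>. F \<subseteq> topspace X) \<and>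
     (\<forall>\<H>\<subseteq>\<F>. X closure_of (\<Union>\<H>) = (\<Union>H\<in>\<H>. X closure_of H))"

(* The operator is a total function in HOL; its values on families that are
   not open covers of X are irrelevant and left unconstrained. *)
definition monotone_cp_operator :: "'a topology \<Rightarrow> ('a set set \<Rightarrow> 'a set set) \<Rightarrow> bool" where
  "monotone_cp_operator X r \<longleftrightarrow>
     (\<forall>\<U>. open_cover_of X \<U> \<longrightarrow>
        cover_of X (r \<U>) \<and> closure_preserving X (r \<U>) \<and> refines (r \<U>) \<U>) \<and>
     (\<forall>\<U> \<V>. open_cover_of X \<U> \<and> open_cover_of X \<V> \<and> refines \<U> \<V> \<longrightarrow>
        refines (r \<U>) (r \<V>))"

definition monotone_open_cp_operator :: "'a topology \<Rightarrow> ('a set set \<Rightarrow> 'a set set) \<Rightarrow> bool" where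
  "monotone_open_cp_operator X r \<longleftrightarrow>
     monotone_cp_operator X r \<and>
     (\<forall>\<U>. open_cover_of X \<U> \<longrightarrow> (\<forall>W\<in>r \<U>. openin X W))"

definition isolated_point_of :: "'a topology \<Rightarrow> 'a \<Rightarrow> bool" where
  "isolated_point_of X x \<longleftrightarrow> x \<in> topspace X \<and> openin X {x}"

end

theory Submission
  imports Defs
begin

text \<open>
  Let \<open>p\<close> be the non-isolated point. Map a cover \<open>\<U>\<close> to the family of all its members containing
  \<open>p\<close> together with the singletons of the points outside the star of \<open>p\<close>. Only \<open>p\<close> can be added
  by taking closures: a subfamily with a member containing \<open>p\<close> has \<open>p\<close> in its union already, and
  the union of any other subfamily misses the star of \<open>p\<close>, a neighbourhood of \<open>p\<close>. Passing to
  a coarser cover enlarges the star, so a singleton either survives or is absorbed by it.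
\<close>

definition star :: "'a set set \<Rightarrow> 'a \<Rightarrow> 'a set" where
  "star \<U> p = \<Union>{U \<in> \<U>. p \<in> U}"

text \<open>The members through \<open>p\<close> are kept one by one: their union, the star, need
  not lie inside a single member of \<U>, so using it as one set could break refinement.\<close>

definition star_operator :: "'a topology \<Rightarrow> 'a \<Rightarrow> 'a set set \<Rightarrow> 'a set set" where
  "star_operator X p \<U> = {U \<in> \<U>. p \<in> U} \<union> (\<lambda>x. {x}) ` (topspace X - star \<U> p)"

lemma point_in_star:
  assumes "open_cover_of X \<U>" "p \<in> topspace X"
  shows "p \<in> star \<U> p"
  using assms unfolding open_cover_of_def cover_of_def star_def by blast

lemma openin_star:
  assumes "open_cover_of X \<U>"
  shows "openin X (star \<U> p)"
  using assms unfolding open_cover_of_def star_def by blast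

text \<open>A point other than \<open>p\<close> outside \<open>S\<close> has its own singleton as a
  neighbourhood missing \<open>S\<close>.\<close>

lemma closure_of_isolated_except:
  assumes iso: "\<And>x. x \<in> topspace X \<Longrightarrow> x \<noteq> p \<Longrightarrow> openin X {x}"
  shows "X closure_of S \<subseteq> insert p S"
proof
  fix x assume x: "x \<in> X closure_of S"
  show "x \<in> insert p S"
  proof (rule ccontr)
    assume "x \<notin> insert p S"
    moreover from this have "openin X {x}"
      using iso x by (simp add: in_closure_of)
    ultimately show False
      using x by (auto simp: in_closure_of)
  qed
qed

lemma cover_of_star_operator:
  assumes "open_cover_of X \<U>"
  shows "cover_of X (star_operator X p \<U>)"
  using assms unfolding open_cover_of_def cover_of_def star_operator_def star_def by blast

lemma refines_star_operator:
  assumes "open_cover_of X \<U>"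
  shows "refines (star_operator X p \<U>) \<U>"
  using assms unfolding open_cover_of_def cover_of_def star_operator_def refines_def by blast

text \<open>A member of \<U> through \<open>p\<close> sits in a member of \<V>, which then contains
  \<open>p\<close> too and so is kept. For a singleton, the case split is on whether its point lies
  in the star taken in \<V>.\<close>

lemma star_operator_mono:
  assumes "refines \<U> \<V>"
  shows "refines (star_operator X p \<U>) (star_operator X p \<V>)"
  unfolding refines_def
proof
  fix A assume "A \<in> star_operator X p \<U>"
  then consider "A \<in> \<U>" "p \<in> A" | x where "A = {x}" "x \<in> topspace X"
    unfolding star_operator_def by blast
  then show "\<exists>B\<in>star_operator X p \<V>. A \<subseteq> B"
  proof cases
    case 1
    then show ?thesis
      using assms unfolding refines_def star_operator_def by blast
  next
    case 2
    then show ?thesis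
      by (cases "x \<in> star \<V> p") (auto simp: star_operator_def star_def)
  qed
qed

text \<open>The star contains \<open>p\<close>, so the added singletons all sit at isolated
  points.\<close>

lemma openin_star_operator:
  assumes "open_cover_of X \<U>" "p \<in> topspace X"
    and "\<And>x. x \<in> topspace X \<Longrightarrow> x \<noteq> p \<Longrightarrow> openin X {x}"
    and "W \<in> star_operator X p \<U>"
  shows "openin X W"
proof -
  consider "W \<in> \<U>" | x where "W = {x}" "x \<in> topspace X" "x \<notin> star \<U> p"
    using assms(4) unfolding star_operator_def by blast
  then show ?thesis
  proof cases
    case 1
    then show ?thesis
      using assms(1) unfolding open_cover_of_def by blast
  next
    case 2
    then have "x \<noteq> p"
      using point_in_star[OF assms(1,2)] by metis
    with 2 show ?thesis
      using assms(3) by simp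
  qed
qed

lemma closure_preserving_star_operator:
  assumes \<U>: "open_cover_of X \<U>" and p: "p \<in> topspace X"
    and iso: "\<And>x. x \<in> topspace X \<Longrightarrow> x \<noteq> p \<Longrightarrow> openin X {x}"
  shows "closure_preserving X (star_operator X p \<U>)"
  unfolding closure_preserving_def
proof (intro conjI ballI allI impI)
  show sub: "W \<subseteq> topspace X" if "W \<in> star_operator X p \<U>" for W
    using openin_star_operator[OF assms that] by (rule openin_subset)
  fix \<H> assume \<H>: "\<H> \<subseteq> star_operator X p \<U>"
  have in_closure: "H \<subseteq> X closure_of H" if "H \<in> \<H>" for H
    using \<H> that by (intro closure_of_subset sub) (rule subsetD)
  show "X closure_of \<Union>\<H> = (\<Union>H\<in>\<H>. X closure_of H)"
  proof
    show "(\<Union>H\<in>\<H>. X closure_of H) \<subseteq> X closure_of \<Union>\<H>"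
      by (intro UN_least closure_of_mono Union_upper)
    \<comment> \<open>If no member of \<open>\<H>\<close> contains \<open>p\<close>, all of them are
      singletons off the star, which is then an open neighbourhood of \<open>p\<close> missing their
      union.\<close>
    have "p \<in> \<Union>\<H>" if "p \<in> X closure_of \<Union>\<H>"
    proof (rule ccontr)
      assume "p \<notin> \<Union>\<H>"
      then have "star \<U> p \<inter> \<Union>\<H> = {}"
        using \<H> unfolding star_operator_def by blast
      then show False
        using that point_in_star[OF \<U> p] openin_star[OF \<U>]
        by (meson disjoint_iff in_closure_of)
    qed
    \<comment> \<open>Since \<open>p\<close> was the only point that could be added, the union is
      already closed.\<close>
    then have "X closure_of \<Union>\<H> \<subseteq> \<Union>\<H>"
      using closure_of_isolated_except[OF iso, where S = "\<Union>\<H>"] by blast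
    then show "X closure_of \<Union>\<H> \<subseteq> (\<Union>H\<in>\<H>. X closure_of H)"
      using in_closure by blast
  qed
qed

theorem theorem1p5:
  fixes X :: "'a topology"
  assumes "\<exists>!p. p \<in> topspace X \<and> \<not> isolated_point_of X p"
  shows "\<exists>r. monotone_open_cp_operator X r"
proof -
  obtain p where p: "p \<in> topspace X"
    and iso: "\<And>x. x \<in> topspace X \<Longrightarrow> x \<noteq> p \<Longrightarrow> openin X {x}"
    using assms unfolding isolated_point_of_def by blast
  have "monotone_open_cp_operator X (star_operator X p)"
    unfolding monotone_open_cp_operator_def monotone_cp_operator_def
    by (auto intro: cover_of_star_operator refines_star_operator star_operator_mono
      closure_preserving_star_operator[OF _ p iso] openin_star_operator[OF _ p iso])
  then show ?thesis by blast
qed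

end
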